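(* Let $\Gamma$ be a finite connected bridgeless graph (multiple edges and loops allowed) with vertex set $\{v_i\}_{i\in I}$ and edge set indexed by $J$, such that $g=\dim H_1(\Gamma,\mathbb{R})\ge 2$. Then there exist an orientation $\{e_j\}_{j\in J}$ of the edges of $\Gamma$ which is strongly connected, and a base vertex $v_0$, such that, with respect to this orientation and base vertex, the crystal $\mathrm{Crystal}(\Gamma)$ does not intrude the interiors of the $g$-dimensional cells of the Voronoi tiling $$\mathrm{Vor}\Big(H,\ \pi\Big(\tfrac{1}{2}\textstyle\sum_{j\in J}e_j\Big)+H_{\mathbb{Z}}\Big);$$ that is, for some $r<g$, $\mathrm{Crystal}(\Gamma)$ is contained in the $r$-skeleton of this Voronoi tiling.
   Context: A graph is bridgeless if removing any single edge leaves it connected. An orientation assigns to each edge $e_j$ a source and a target; it is strongly connected if for any two vertices there is a directed path from one to the other. Given an orientation, $C=C_1(\Gamma,\mathbb{R})=\bigoplus_{j\in J}\mathbb{R}e_j$ with the inner product making $\{e_j\}$ orthonormal, $\Lambda=\bigoplus_j\mathbb{Z}e_j$, $\partial(e_j)=\operatorname{source}(e_j)-\operatorname{target}(e_j)$, $H=\ker\partial=H_1(\Gamma,\mathbb{R})$, $H_{\mathbb{Z}}=H\cap\Lambda$, and $\pi:C\to H$ is the orthogonal projection. A walk $w$ from $v_0$ is a sequence $v_{i(0)}=v_0,v_{i(1)},\dots,v_{i(m)}$ of vertices together with signed edges $\varepsilon_le_{j(l)}$ ($\varepsilon_l=\pm1$, $1\le l\le m$) such that $\varepsilon_le_{j(l)}$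 goes from $v_{i(l-1)}$ to $v_{i(l)}$ (where $-e$ means $e$ traversed from its target to its source). Put $\lambda(w_l)=\sum_{k=1}^{l}\varepsilon_ke_{j(k)}\in\Lambda$ (with $\lambda(w_0)=0$), and let $\mathrm{pc}(w)=\bigcup_{l=1}^m[\lambda(w_{l-1}),\lambda(w_l)]\subset C$ be the union of line segments. The crystal is $\mathrm{Crystal}(\Gamma)=\bigcup_{w}\pi(\mathrm{pc}(w))\subset H$, the union over all walks $w$ starting at $v_0$ (the image of the Kotani–Sunada standard realization of the maximal abelian covering of $\Gamma$). For a lattice $M\subset H$ and $\xi_0\in H$, the Voronoi cell of $\xi\in\xi_0+M$ is $V(\xi)=\{x\in H:\|x-\xi\|\le\|x-\eta\|\ \forall\eta\in\xi_0+M\}$; the Voronoi tiling $\mathrm{Vor}(H,\xi_0+M)$ consists of all these cells and their faces, and its $r$-skeleton is the union of its faces of dimension at most $r$. *)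

theory Defs
  imports "HOL-Analysis.Analysis" "HOL-Library.Uprod"
begin

text \<open>
  A finite multigraph, loops allowed, is given by the map sending each edge to its unordered pair
  of end points; the vertex and edge sets are the finite types \<open>'v\<close> and \<open>'e\<close>.
\<close>

type_synonym ('e, 'v) mgraph = "'e \<Rightarrow> 'v uprod"

definition connected_by :: "('e, 'v) mgraph \<Rightarrow> 'e set \<Rightarrow> bool" where
  "connected_by G E \<longleftrightarrow> (\<forall>u v. (u, v) \<in> {(x, y). \<exists>j\<in>E. G j = Upair x y}\<^sup>*)"

definition connected_graph :: "('e, 'v) mgraph \<Rightarrow> bool" where
  "connected_graph G \<longleftrightarrow> connected_by G UNIV"

definition bridgeless :: "('e, 'v) mgraph \<Rightarrow> bool" where
  "bridgeless G \<longleftrightarrow> (\<forall>j. connected_by G (UNIV - {j}))"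

definition orientation :: "('e, 'v) mgraph \<Rightarrow> ('e \<Rightarrow> 'v) \<Rightarrow> ('e \<Rightarrow> 'v) \<Rightarrow> bool" where
  "orientation G src tgt \<longleftrightarrow> (\<forall>j. G j = Upair (src j) (tgt j))"

definition strongly_connected :: "('e \<Rightarrow> 'v) \<Rightarrow> ('e \<Rightarrow> 'v) \<Rightarrow> bool" where
  "strongly_connected src tgt \<longleftrightarrow> (\<forall>u v. (u, v) \<in> (range (\<lambda>j. (src j, tgt j)))\<^sup>*)"

definition boundary :: "('e::finite \<Rightarrow> 'v::finite) \<Rightarrow> ('e \<Rightarrow> 'v) \<Rightarrow> real^'e \<Rightarrow> real^'v" where
  "boundary src tgt x = (\<Sum>j\<in>UNIV. (x $ j) *\<^sub>R (axis (src j) 1 - axis (tgt j) 1))"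

definition H1 :: "('e::finite \<Rightarrow> 'v::finite) \<Rightarrow> ('e \<Rightarrow> 'v) \<Rightarrow> (real^'e) set" where
  "H1 src tgt = {x. boundary src tgt x = 0}"

definition H1_int :: "('e::finite \<Rightarrow> 'v::finite) \<Rightarrow> ('e \<Rightarrow> 'v) \<Rightarrow> (real^'e) set" where
  "H1_int src tgt = H1 src tgt \<inter> {x. \<forall>j. x $ j \<in> \<int>}"

text \<open>
  The dimension of \<open>H1\<close> does not depend on the orientation used to compute it, see \<open>dim_H1\<close> below.
\<close>

definition betti1 :: "('e::finite, 'v::finite) mgraph \<Rightarrow> nat" where
  "betti1 G = dim (case (SOME (src, tgt). orientation G src tgt) of (src, tgt) \<Rightarrow> H1 src tgt)"

lemma ex_orientation: "\<exists>src tgt. orientation G src tgt"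
proof -
  have "\<forall>j. \<exists>p. G j = Upair (fst p) (snd p)"
  proof
    fix j show "\<exists>p. G j = Upair (fst p) (snd p)"
      by (cases "G j") auto
  qed
  then obtain p where "\<forall>j. G j = Upair (fst (p j)) (snd (p j))"
    by metis
  then have "orientation G (\<lambda>j. fst (p j)) (\<lambda>j. snd (p j))"
    by (simp add: orientation_def)
  then show ?thesis by blast
qed

lemma dim_H1_le:
  fixes G :: "('e::finite, 'v::finite) mgraph"
  assumes "orientation G s t" "orientation G s' t'"
  shows "dim (H1 s t) \<le> dim (H1 s' t')"
proof -
  define \<sigma> :: "'e \<Rightarrow> real" where "\<sigma> j = (if s' j = s j \<and> t' j = t j then 1 else -1)" for j
  define f :: "real^'e \<Rightarrow> real^'e" where "f x = (\<chi> j. \<sigma> j * x $ j)" for x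
  have lin: "linear f"
    by (rule linearI) (simp_all add: f_def vec_eq_iff algebra_simps)
  have ff: "f (f x) = x" for x
    by (simp add: f_def \<sigma>_def vec_eq_iff)
  have inj: "inj f"
    by (metis ff injI)
  have ends: "(s' j = s j \<and> t' j = t j) \<or> (s' j = t j \<and> t' j = s j)" for j
    using assms unfolding orientation_def by (metis Upair_inject)
  have "boundary s' t' (f x) = boundary s t x" for x
    unfolding boundary_def
  proof (rule sum.cong[OF refl])
    fix j
    show "f x $ j *\<^sub>R (axis (s' j) 1 - axis (t' j) 1) = x $ j *\<^sub>R (axis (s j) 1 - axis (t j) (1::real))"
      using ends[of j] by (auto simp: f_def \<sigma>_def algebra_simps)
  qed
  then have "f ` H1 s t \<subseteq> H1 s' t'"
    by (auto simp: H1_def)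
  then have "dim (f ` H1 s t) \<le> dim (H1 s' t')"
    by (rule dim_subset)
  moreover have "dim (f ` H1 s t) = dim (H1 s t)"
    using lin inj by (intro dim_image_eq) (auto intro: inj_on_subset)
  ultimately show ?thesis by simp
qed

lemma dim_H1:
  assumes "orientation G src tgt"
  shows "dim (H1 src tgt) = betti1 G"
proof -
  obtain s t where st: "(SOME (src, tgt). orientation G src tgt) = (s, t)"
    by (cases "SOME (src, tgt). orientation G src tgt")
  have "case (SOME (src, tgt). orientation G src tgt) of (src, tgt) \<Rightarrow> orientation G src tgt"
    by (rule someI[of _ "(src, tgt)"]) (simp add: assms)
  then have "orientation G s t"
    by (simp add: st)
  then show ?thesis
    using assms by (auto simp: betti1_def st intro: antisym dim_H1_le)
qed

definition orth_proj :: "'a::euclidean_space set \<Rightarrow> 'a \<Rightarrow> 'a" where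
  "orth_proj S x = (THE y. y \<in> S \<and> (\<forall>z\<in>S. orthogonal (x - y) z))"

lemma orth_proj:
  assumes "subspace S"
  shows "orth_proj S x \<in> S" "z \<in> S \<Longrightarrow> orthogonal (x - orth_proj S x) z"
proof -
  have "\<exists>!y. y \<in> S \<and> (\<forall>z\<in>S. orthogonal (x - y) z)"
  proof (rule ex_ex1I)
    obtain y w where "y \<in> span S" "\<And>z. z \<in> span S \<Longrightarrow> orthogonal w z" "x = y + w"
      using orthogonal_subspace_decomp_exists[of S x] by metis
    then show "\<exists>y. y \<in> S \<and> (\<forall>z\<in>S. orthogonal (x - y) z)"
      using span_eq_iff[THEN iffD2, OF assms] by (intro exI[of _ y]) auto
  next
    fix y y'
    assume y: "y \<in> S \<and> (\<forall>z\<in>S. orthogonal (x - y) z)"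
      and y': "y' \<in> S \<and> (\<forall>z\<in>S. orthogonal (x - y') z)"
    then have "y - y' \<in> S"
      using assms by (simp add: subspace_diff)
    then have "(x - y') \<bullet> (y - y') - (x - y) \<bullet> (y - y') = 0"
      using y y' by (simp add: orthogonal_def)
    then have "(y - y') \<bullet> (y - y') = 0"
      by (simp add: inner_diff_left)
    then show "y = y'" by simp
  qed
  from theI'[OF this] show "orth_proj S x \<in> S" "z \<in> S \<Longrightarrow> orthogonal (x - orth_proj S x) z"
    by (auto simp: orth_proj_def)
qed

definition signed_edge_from_to ::
  "('e \<Rightarrow> 'v) \<Rightarrow> ('e \<Rightarrow> 'v) \<Rightarrow> int \<times> 'e \<Rightarrow> 'v \<Rightarrow> 'v \<Rightarrow> bool" where
  "signed_edge_from_to src tgt d u v \<longleftrightarrow>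
     fst d = 1 \<and> src (snd d) = u \<and> tgt (snd d) = v \<or>
     fst d = -1 \<and> tgt (snd d) = u \<and> src (snd d) = v"

definition is_walk ::
  "('e \<Rightarrow> 'v) \<Rightarrow> ('e \<Rightarrow> 'v) \<Rightarrow> 'v \<Rightarrow> 'v list \<Rightarrow> (int \<times> 'e) list \<Rightarrow> bool" where
  "is_walk src tgt v0 vs ds \<longleftrightarrow>
     length vs = length ds + 1 \<and> vs ! 0 = v0 \<and>
     (\<forall>l<length ds. signed_edge_from_to src tgt (ds ! l) (vs ! l) (vs ! (l + 1)))"

definition walk_chain :: "(int \<times> 'e::finite) list \<Rightarrow> nat \<Rightarrow> real^'e" where
  "walk_chain ds l = (\<Sum>k<l. of_int (fst (ds ! k)) *\<^sub>R axis (snd (ds ! k)) 1)"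

definition pc :: "(int \<times> 'e::finite) list \<Rightarrow> (real^'e) set" where
  "pc ds = (\<Union>l\<in>{1..length ds}. closed_segment (walk_chain ds (l - 1)) (walk_chain ds l))"

definition crystal :: "('e::finite \<Rightarrow> 'v::finite) \<Rightarrow> ('e \<Rightarrow> 'v) \<Rightarrow> 'v \<Rightarrow> (real^'e) set" where
  "crystal src tgt v0 =
     \<Union>{orth_proj (H1 src tgt) ` pc ds | vs ds. is_walk src tgt v0 vs ds}"

text \<open>
  In the following, \<open>H\<close> is the ambient subspace and \<open>X\<close> the set of sites. The skeleton uses the
  library's \<open>face_of\<close>, for which a cell is a face of itself and the empty set is a face.
\<close>

definition voronoi_cell :: "'a::euclidean_space set \<Rightarrow> 'a set \<Rightarrow> 'a \<Rightarrow> 'a set" where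
  "voronoi_cell H X \<xi> = {x \<in> H. \<forall>\<eta>\<in>X. norm (x - \<xi>) \<le> norm (x - \<eta>)}"

definition voronoi_tiling :: "'a::euclidean_space set \<Rightarrow> 'a set \<Rightarrow> 'a set set" where
  "voronoi_tiling H X = {F. \<exists>\<xi>\<in>X. F face_of voronoi_cell H X \<xi>}"

definition skeleton :: "nat \<Rightarrow> 'a::euclidean_space set set \<Rightarrow> 'a set" where
  "skeleton r T = \<Union>{F \<in> T. aff_dim F \<le> int r}"

definition crystal_sites :: "('e::finite \<Rightarrow> 'v::finite) \<Rightarrow> ('e \<Rightarrow> 'v) \<Rightarrow> (real^'e) set" where
  "crystal_sites src tgt =
     (+) (orth_proj (H1 src tgt) ((1/2) *\<^sub>R (\<Sum>j\<in>UNIV. axis j 1))) ` H1_int src tgt"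

end

theory Submission imports Defs begin

text \<open>
  Orient \<open>G\<close> strongly and let \<open>v\<^sub>0\<close> have out-degree at least two, which is possible since
  \<open>g \<ge> 2\<close>. Modulo \<open>H\<^sub>\<int>\<close> every edge of the crystal is the projection of \<open>\<lambda> + [0, 1] e\<close>, where \<open>\<lambda>\<close> is
  a \<open>0/1\<close>-chain from \<open>v\<^sub>0\<close> to the source of \<open>e\<close> that avoids \<open>e\<close>. Reverse the edges of \<open>\<lambda>\<close> and remove
  \<open>e\<close>: the out-degrees stay the same except that the one at \<open>v\<^sub>0\<close> drops by one, so they are all
  positive and a directed cycle remains. Its chain \<open>h\<close> lies in \<open>H\<^sub>\<int>\<close> and, for every point \<open>p\<close> of
  \<open>\<lambda> + [0, 1] e\<close> and the centre \<open>c\<close> of the unit cube, \<open>2 (p - c) \<bullet> h = h \<bullet> h\<close>, whereas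
  \<open>2 (p - c) \<bullet> z \<le> z \<bullet> z\<close> for all integral \<open>z\<close>. Hence the projection of \<open>p\<close> has two nearest sites.
\<close>

section \<open>Strong orientations\<close>

text \<open>Only the edges in \<open>B\<close> are one-way streets.\<close>

definition arcs :: "('e \<Rightarrow> 'v) \<Rightarrow> ('e \<Rightarrow> 'v) \<Rightarrow> 'e set \<Rightarrow> 'e set \<Rightarrow> ('v \<times> 'v) set" where
  "arcs src tgt B E = {(x, y). \<exists>j\<in>E. src j = x \<and> tgt j = y \<or> j \<notin> B \<and> tgt j = x \<and> src j = y}"

text \<open>
  If neither direction of the two-way edge \<open>k\<close> could be dropped, the sets reachable from its two
  ends without using \<open>k\<close> would partition the vertices, and \<open>k\<close> would be a bridge.
\<close>

lemma reachable_without_edge: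
  fixes k :: 'e
  assumes ori: "orientation G src tgt" and bl: "bridgeless G"
    and strong: "\<And>x y. (x, y) \<in> (arcs src tgt B UNIV)\<^sup>*"
  defines "A \<equiv> arcs src tgt B (- {k})"
  shows "(src k, tgt k) \<in> A\<^sup>* \<or> (tgt k, src k) \<in> A\<^sup>*"
proof (rule ccontr)
  assume neg: "\<not> ?thesis"
  define U where "U = A\<^sup>* `` {src k}"
  define W where "W = A\<^sup>* `` {tgt k}"
  have notin: "tgt k \<notin> U" "src k \<notin> W" and mem: "src k \<in> U" "tgt k \<in> W"
    using neg by (auto simp: U_def W_def)
  have clU: "y \<in> U" if "x \<in> U" "(x, y) \<in> A" for x y
    using that by (auto simp: U_def intro: rtrancl_into_rtrancl)
  have clW: "y \<in> W" if "x \<in> W" "(x, y) \<in> A" for x y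
    using that by (auto simp: W_def intro: rtrancl_into_rtrancl)
  have arc: "(x, y) \<in> A \<or> x = src k \<and> y = tgt k \<or> x = tgt k \<and> y = src k"
    if "(x, y) \<in> arcs src tgt B UNIV" for x y
    using that by (auto simp: A_def arcs_def)
  \<comment> \<open>Neither end of \<open>k\<close> lies in both sets, so
    \<open>U \<inter> W\<close> is closed under all arcs. Were it nonempty, it would be
    everything.\<close>
  have inter: "x \<notin> U \<inter> W" for x
  proof
    assume x: "x \<in> U \<inter> W"
    have "y \<in> U \<inter> W" if "(x, y) \<in> (arcs src tgt B UNIV)\<^sup>*" for y
      using that
    proof induction
      case (step y z)
      then show ?case using arc[OF step(2)] clU clW notin by blast
    qed (use x in simp)
    then show False using strong notin by blast
  qed
  have union: "x \<in> U \<union> W" for x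
    using strong[of "src k" x]
  proof induction
    case (step y z)
    then show ?case using arc[OF step(2)] clU clW mem by blast
  qed (use mem in simp)
  have "(src k, tgt k) \<in> {(x, y). \<exists>j\<in>UNIV - {k}. G j = Upair x y}\<^sup>*"
    using bl by (simp add: bridgeless_def connected_by_def)
  then have "tgt k \<in> U"
  proof induction
    case (step y z)
    then obtain j where j: "j \<noteq> k" "Upair (src j) (tgt j) = Upair y z"
      using ori by (auto simp: orientation_def)
    \<comment> \<open>The path avoiding \<open>k\<close> may run against a one-way edge. It still
      cannot pass from \<open>U\<close> to \<open>W\<close>, as the arc would then lead from
      \<open>W\<close> back into \<open>U\<close>.\<close>
    then have "(y, z) \<in> A \<or> (z, y) \<in> A"
      by (auto simp: A_def arcs_def)
    then show ?case
      using step.IH clU clW union inter by blast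
  qed (use mem in simp)
  then show False using notin by simp
qed

text \<open>Robbins' theorem, with the edges made one-way one at a time. For empty \<open>B\<close>
  the claim is connectedness; for \<open>B = UNIV\<close> it is strong connectedness.\<close>

lemma ex_strong_orientation_on:
  fixes G :: "('e::finite, 'v) mgraph"
  assumes con: "connected_graph G" and bl: "bridgeless G"
  shows "\<exists>src tgt. orientation G src tgt \<and> (\<forall>x y. (x, y) \<in> (arcs src tgt B UNIV)\<^sup>*)"
  using finite[of B]
proof (induction B)
  case empty
  obtain src tgt where ori: "orientation G src tgt"
    using ex_orientation by blast
  have "{(x, y). \<exists>j\<in>UNIV. G j = Upair x y} \<subseteq> arcs src tgt {} UNIV"
    using ori by (auto simp: orientation_def arcs_def)
  then show ?case
    using con ori rtrancl_mono unfolding connected_graph_def connected_by_def by blast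
next
  case (insert k B)
  then obtain src tgt where ori: "orientation G src tgt"
    and strong: "\<And>x y. (x, y) \<in> (arcs src tgt B UNIV)\<^sup>*"
    by blast
  define A where "A = arcs src tgt B (- {k})"
  \<comment> \<open>The path from \<open>t k\<close> to \<open>s k\<close> in \<open>A\<close>
    avoids \<open>k\<close> and replaces the direction lost when \<open>k\<close> becomes one-way
    from \<open>s k\<close> to \<open>t k\<close>.\<close>
  have reduce: ?case
    if o: "orientation G s t" and same: "\<And>j. j \<noteq> k \<Longrightarrow> s j = src j \<and> t j = tgt j"
      and ends: "s k = src k \<and> t k = tgt k \<or> s k = tgt k \<and> t k = src k"
      and path: "(t k, s k) \<in> A\<^sup>*" for s t
  proof -
    let ?R = "arcs s t (insert k B) UNIV"
    have AR: "A \<subseteq> ?R"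
      using same by (auto simp: A_def arcs_def)
    have "(s k, t k) \<in> ?R\<^sup>*" "(t k, s k) \<in> ?R\<^sup>*"
      using path rtrancl_mono[OF AR] by (auto simp: arcs_def)
    then have k: "(src k, tgt k) \<in> ?R\<^sup>*" "(tgt k, src k) \<in> ?R\<^sup>*"
      using ends by auto
    have "arcs src tgt B UNIV \<subseteq> ?R\<^sup>*"
    proof
      fix p assume "p \<in> arcs src tgt B UNIV"
      then have "p \<in> A \<or> p = (src k, tgt k) \<or> p = (tgt k, src k)"
        by (auto simp: A_def arcs_def)
      then show "p \<in> ?R\<^sup>*"
        using k AR by auto
    qed
    then have "(arcs src tgt B UNIV)\<^sup>* \<subseteq> ?R\<^sup>*"
      using rtrancl_subset_rtrancl by blast
    then show ?thesis
      using o strong by blast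
  qed
  have "(src k, tgt k) \<in> A\<^sup>* \<or> (tgt k, src k) \<in> A\<^sup>*"
    unfolding A_def by (rule reachable_without_edge[OF ori bl strong])
  then show ?case
  proof
    assume "(tgt k, src k) \<in> A\<^sup>*"
    then show ?thesis
      using ori by (intro reduce[of src tgt]) auto
  next
    assume "(src k, tgt k) \<in> A\<^sup>*"
    moreover have "orientation G (src(k := tgt k)) (tgt(k := src k))"
      using ori by (auto simp: orientation_def)
    ultimately show ?thesis
      by (intro reduce[of "src(k := tgt k)" "tgt(k := src k)"]) auto
  qed
qed

theorem ex_strong_orientation:
  fixes G :: "('e::finite, 'v) mgraph"
  assumes "connected_graph G" and "bridgeless G"
  obtains src tgt where "orientation G src tgt" "strongly_connected src tgt"
proof -
  have "arcs src tgt UNIV UNIV = range (\<lambda>j. (src j, tgt j))" for src tgt :: "'e \<Rightarrow> 'v"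
    by (auto simp: arcs_def)
  then show ?thesis
    using ex_strong_orientation_on[OF assms, of UNIV] that
    by (auto simp: strongly_connected_def)
qed

section \<open>Chains and cycles\<close>

lemma boundary_nth:
  "boundary src tgt x $ w = (\<Sum>j\<in>UNIV. x $ j * (of_bool (src j = w) - of_bool (tgt j = w)))"
  by (auto simp: boundary_def axis_def intro!: sum.cong)

lemma linear_boundary: "linear (boundary src tgt)"
  by (rule linearI)
    (simp_all add: boundary_def scaleR_add_left sum.distrib scaleR_sum_right)

lemma boundary_axis: "boundary src tgt (axis j 1) = axis (src j) 1 - axis (tgt j) 1"
proof -
  have "axis j 1 $ i *\<^sub>R (axis (src i) 1 - axis (tgt i) 1 :: real^_)
      = (if i = j then axis (src j) 1 - axis (tgt j) 1 else 0)" for i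
    by (auto simp: axis_def)
  then show ?thesis
    by (simp add: boundary_def)
qed

lemma subspace_H1: "subspace (H1 src tgt)"
  unfolding H1_def by (rule linear_subspace_kernel[OF linear_boundary])

lemma H1_int_add:
  assumes "x \<in> H1_int src tgt" "y \<in> H1_int src tgt"
  shows "x + y \<in> H1_int src tgt"
  using assms subspace_add[OF subspace_H1] by (auto simp: H1_int_def)

lemma H1_int_diff:
  assumes "x \<in> H1_int src tgt" "y \<in> H1_int src tgt"
  shows "x - y \<in> H1_int src tgt"
  using assms subspace_diff[OF subspace_H1] by (auto simp: H1_int_def)

lemma strongly_connected_surj_tgt:
  assumes "strongly_connected src tgt"
  shows "surj tgt"
proof -
  have "w \<in> range tgt" for w
  proof -
    \<comment> \<open>Starting at a target makes the empty path harmless; otherwise the last arc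
      ends in \<open>w\<close>.\<close>
    have "(tgt undefined, w) \<in> (range (\<lambda>j. (src j, tgt j)))\<^sup>*"
      using assms by (simp add: strongly_connected_def)
    then show ?thesis
      by cases auto
  qed
  then show ?thesis by auto
qed

lemma strongly_connected_surj_src:
  assumes "strongly_connected src tgt"
  shows "surj src"
proof -
  have "w \<in> range src" for w
  proof -
    have "(w, src undefined) \<in> (range (\<lambda>j. (src j, tgt j)))\<^sup>*"
      using assms by (simp add: strongly_connected_def)
    then show ?thesis
      by (cases rule: converse_rtranclE) auto
  qed
  then show ?thesis by auto
qed

text \<open>If every out-degree is one, then \<open>G\<close> is a single directed cycle.\<close>

lemma dim_H1_le_1_if_inj_src:
  fixes src tgt :: "'e::finite \<Rightarrow> 'v::finite"
  assumes sc: "strongly_connected src tgt" and inj: "inj src"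
  shows "dim (H1 src tgt) \<le> 1"
proof -
  have "CARD('e) \<le> CARD('v)"
    by (rule card_inj_on_le[OF inj]) auto
  moreover have "card (range tgt) = CARD('v)"
    using strongly_connected_surj_tgt[OF sc] by simp
  moreover have "card (range tgt) \<le> CARD('e)"
    by (rule card_image_le) simp
  ultimately have inj': "inj tgt"
    by (intro eq_card_imp_inj_on) auto
  have "x \<in> span {\<chi> j. 1}" if x: "x \<in> H1 src tgt" for x
  proof -
    \<comment> \<open>The flow out of \<open>w\<close>, equal to the flow into \<open>w\<close> for
      a cycle. As each vertex has one outgoing and one incoming edge, it is carried unchanged along
      every arc.\<close>
    define f where "f w = (\<Sum>j\<in>UNIV. x $ j * of_bool (src j = w))" for w
    have f': "f w = (\<Sum>j\<in>UNIV. x $ j * of_bool (tgt j = w))" for w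
    proof -
      have "boundary src tgt x $ w = 0"
        using x by (simp add: H1_def)
      then show ?thesis
        by (simp add: boundary_nth f_def right_diff_distrib sum_subtractf)
    qed
    have f_src: "f (src j) = x $ j" for j
      using inj by (simp add: f_def inj_eq of_bool_def if_distrib cong: if_cong)
    have f_tgt: "f (tgt j) = x $ j" for j
      using inj' by (simp add: f' inj_eq of_bool_def if_distrib cong: if_cong)
    have const: "f v = f u" for u v
    proof -
      have "(u, v) \<in> (range (\<lambda>j. (src j, tgt j)))\<^sup>*"
        using sc by (simp add: strongly_connected_def)
      then show ?thesis
        by induction (auto simp: f_src f_tgt)
    qed
    have "x = f undefined *\<^sub>R (\<chi> j. 1)"
      using const f_src by (simp add: vec_eq_iff) metis
    then show ?thesis
      by (metis span_base span_scale singletonI)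
  qed
  then have "dim (H1 src tgt) \<le> card {\<chi> j. 1 :: real^'e}"
    by (intro dim_le_card) auto
  then show ?thesis by simp
qed

text \<open>
  A shortest path: the bound on the distances of the sources ensures that no edge is repeated.
\<close>

lemma ex_path_chain_relpow:
  fixes src tgt :: "'e::finite \<Rightarrow> 'v::finite"
  defines "R \<equiv> range (\<lambda>j. (src j, tgt j))"
  assumes "(v0, u) \<in> R ^^ n" "\<And>m. m < n \<Longrightarrow> (v0, u) \<notin> R ^^ m"
  shows "\<exists>x. (\<forall>j. x $ j = 0 \<or> x $ j = 1) \<and>
    (\<forall>j. x $ j = 1 \<longrightarrow> (\<exists>m<n. (v0, src j) \<in> R ^^ m)) \<and>
    boundary src tgt x = axis v0 1 - axis u 1"
  using assms(2,3)
proof (induction n arbitrary: u)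
  case 0
  then show ?case
    by (intro exI[of _ 0]) (simp add: linear_0[OF linear_boundary])
next
  case (Suc n)
  then obtain j where j: "(v0, src j) \<in> R ^^ n" "u = tgt j"
    by (auto simp: R_def)
  have min: "(v0, src j) \<notin> R ^^ m" if "m < n" for m
  proof
    assume "(v0, src j) \<in> R ^^ m"
    then have "(v0, u) \<in> R ^^ Suc m"
      using j by (auto simp: R_def)
    then show False
      using Suc.prems(2)[of "Suc m"] that by simp
  qed
  obtain x where x: "\<And>i. x $ i = 0 \<or> x $ i = 1"
    "\<And>i. x $ i = 1 \<Longrightarrow> \<exists>m<n. (v0, src i) \<in> R ^^ m"
    "boundary src tgt x = axis v0 1 - axis (src j) 1"
    using Suc.IH[OF j(1) min] by blast
  have xj: "x $ j = 0"
    using x(1)[of j] x(2)[of j] min by auto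
  show ?case
  proof (intro exI[of _ "x + axis j 1"] conjI allI impI)
    fix i
    show "(x + axis j 1) $ i = 0 \<or> (x + axis j 1) $ i = 1"
      using x(1)[of i] xj by (auto simp: axis_def)
    show "\<exists>m<Suc n. (v0, src i) \<in> R ^^ m" if "(x + axis j 1) $ i = 1"
    proof (cases "i = j")
      case True
      then show ?thesis using j by auto
    next
      case False
      then have "x $ i = 1"
        using that by (simp add: axis_def)
      then show ?thesis
        using x(2) less_SucI by blast
    qed
    show "boundary src tgt (x + axis j 1) = axis v0 1 - axis u 1"
      using x(3) j by (simp add: linear_add[OF linear_boundary] boundary_axis)
  qed
qed

text \<open>A shortest path to \<open>u\<close> uses only edges whose source is strictly closer to
  \<open>v0\<close> than \<open>u\<close>, hence no edge leaving \<open>u\<close>. In particular it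
  avoids the edge about to be traversed from \<open>u\<close>.\<close>

lemma ex_path_chain:
  fixes src tgt :: "'e::finite \<Rightarrow> 'v::finite"
  assumes "strongly_connected src tgt"
  obtains x where "\<And>j. x $ j = 0 \<or> x $ j = 1" "\<And>j. src j = u \<Longrightarrow> x $ j = 0"
    "boundary src tgt x = axis v0 1 - axis u 1"
proof -
  let ?R = "range (\<lambda>j. (src j, tgt j))"
  have "\<exists>n. (v0, u) \<in> ?R ^^ n"
    using assms by (simp add: strongly_connected_def rtrancl_imp_relpow)
  then have "\<exists>n. (v0, u) \<in> ?R ^^ n \<and> (\<forall>m<n. (v0, u) \<notin> ?R ^^ m)"
    using exists_least_iff[of "\<lambda>n. (v0, u) \<in> ?R ^^ n"] by blast
  then obtain n where n: "(v0, u) \<in> ?R ^^ n" "\<And>m. m < n \<Longrightarrow> (v0, u) \<notin> ?R ^^ m"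
    by blast
  obtain x where x: "\<And>j. x $ j = 0 \<or> x $ j = 1"
    "\<And>j. x $ j = 1 \<Longrightarrow> \<exists>m<n. (v0, src j) \<in> ?R ^^ m"
    "boundary src tgt x = axis v0 1 - axis u 1"
    using ex_path_chain_relpow[OF n] by blast
  show ?thesis
    using x n(2) by (intro that[of x]) metis+
qed

text \<open>A nonempty set of least size that \<open>f\<close> maps into itself is permuted by
  \<open>f\<close>, since its image is again such a set. For a successor map on vertices this yields
  a directed cycle.\<close>

lemma ex_bij_betw_invariant:
  fixes f :: "'a::finite \<Rightarrow> 'a"
  obtains C where "C \<noteq> {}" "bij_betw f C C"
proof -
  have "\<exists>C. (C \<noteq> {} \<and> f ` C \<subseteq> C) \<and> (\<forall>D. D \<noteq> {} \<and> f ` D \<subseteq> D \<longrightarrow> card C \<le> card D)"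
    by (rule ex_has_least_nat[of _ UNIV]) auto
  then obtain C where C: "C \<noteq> {}" "f ` C \<subseteq> C"
    and min: "\<And>D. D \<noteq> {} \<Longrightarrow> f ` D \<subseteq> D \<Longrightarrow> card C \<le> card D"
    by metis
  have "card C \<le> card (f ` C)"
    by (rule min) (use C in auto)
  then have "f ` C = C"
    using C(2) by (intro card_seteq) auto
  then have "bij_betw f C C"
    by (simp add: bij_betw_def eq_card_imp_inj_on)
  then show ?thesis
    using C(1) by (rule that[rotated])
qed

text \<open>Choosing at each vertex an outgoing edge other than \<open>e\<close> of the reversed
  graph gives a successor map \<open>head \<circ> k\<close>, to which the previous lemma
  applies.\<close>

lemma ex_cycle_after_reversal:
  fixes src tgt :: "'e::finite \<Rightarrow> 'v::finite" and x :: "real^'e"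
  assumes x01: "\<And>j. x $ j = 0 \<or> x $ j = 1"
    and out: "\<And>w. \<exists>j. j \<noteq> e \<and> (if x $ j = 0 then src j else tgt j) = w"
  obtains h where "h \<in> H1_int src tgt" "h \<noteq> 0" "h $ e = 0"
    "\<And>j. h $ j = 0 \<or> h $ j = 2 * x $ j - 1"
proof -
  define tail where "tail j = (if x $ j = 0 then src j else tgt j)" for j
  define head where "head j = (if x $ j = 0 then tgt j else src j)" for j
  obtain k where k: "\<And>w. k w \<noteq> e" "\<And>w. tail (k w) = w"
    using out unfolding tail_def by metis
  have inj: "inj k"
    by (metis injI k(2))
  obtain C where C: "C \<noteq> {}" "bij_betw (head \<circ> k) C C"
    by (rule ex_bij_betw_invariant)
  \<comment> \<open>The negative of the cycle's chain: this sign makes \<open>h\<close> agree on its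
    support with twice the offset of \<open>x\<close> from the cube's centre.\<close>
  define h :: "real^'e" where "h = (\<Sum>w\<in>C. (2 * x $ k w - 1) *\<^sub>R axis (k w) 1)"
  have h_nth: "h $ j = (if j \<in> k ` C then 2 * x $ j - 1 else 0)" for j
  proof -
    have "h $ j = (\<Sum>w\<in>C. if k w = j then 2 * x $ j - 1 else 0)"
      by (auto simp: h_def axis_def intro!: sum.cong)
    also have "\<dots> = (\<Sum>i\<in>k ` C. if i = j then 2 * x $ j - 1 else 0)"
      using inj by (subst sum.reindex) (auto intro: inj_on_subset)
    finally show ?thesis by simp
  qed
  have "boundary src tgt h
      = (\<Sum>w\<in>C. (2 * x $ k w - 1) *\<^sub>R (axis (src (k w)) 1 - axis (tgt (k w)) 1))"
    by (simp add: h_def linear_sum[OF linear_boundary] linear_cmul[OF linear_boundary]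
        boundary_axis)
  also have "\<dots> = (\<Sum>w\<in>C. axis ((head \<circ> k) w) 1 - axis w 1)"
  proof (rule sum.cong[OF refl])
    fix w
    show "(2 * x $ k w - 1) *\<^sub>R (axis (src (k w)) 1 - axis (tgt (k w)) 1)
        = axis ((head \<circ> k) w) 1 - axis w (1::real)"
      using x01[of "k w"] k(2)[of w] by (auto simp: head_def tail_def)
  qed
  also have "\<dots> = 0"
    using sum.reindex_bij_betw[OF C(2), of "\<lambda>w. axis w 1 :: real^'v"]
    by (simp add: sum_subtractf)
  finally have "h \<in> H1 src tgt"
    by (simp add: H1_def)
  moreover have "h $ j \<in> \<int>" for j
    using x01[of j] by (auto simp: h_nth)
  ultimately have "h \<in> H1_int src tgt"
    by (simp add: H1_int_def)
  moreover have "h \<noteq> 0"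
  proof -
    obtain w where "w \<in> C" using C by blast
    then have "h $ k w \<noteq> 0"
      using x01[of "k w"] by (auto simp: h_nth)
    then show ?thesis by auto
  qed
  ultimately show ?thesis
    using k(1) by (intro that[of h]) (auto simp: h_nth)
qed

text \<open>Reversing an edge moves one unit of out-degree from its source to its target, so the
  total change is minus the boundary of \<open>x\<close>. The unit gained at \<open>src e\<close> is
  cancelled by deleting \<open>e\<close>.\<close>

lemma outdegree_after_reversal:
  fixes src tgt :: "'e::finite \<Rightarrow> 'v::finite" and x :: "real^'e"
  assumes x01: "\<And>j. x $ j = 0 \<or> x $ j = 1" and xe: "x $ e = 0"
    and bd: "boundary src tgt x = axis v0 1 - axis (src e) 1"
  shows "real (card {j. j \<noteq> e \<and> (if x $ j = 0 then src j else tgt j) = w})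
    = real (card {j. src j = w}) - of_bool (w = v0)"
proof -
  have card: "real (card {j. P j}) = (\<Sum>j\<in>UNIV. of_bool (P j))" for P :: "'e \<Rightarrow> bool"
    by (simp add: of_bool_def sum.If_cases)
  have pointwise: "of_bool (j \<noteq> e \<and> (if x $ j = 0 then src j else tgt j) = w)
      = of_bool (src j = w) - x $ j * (of_bool (src j = w) - of_bool (tgt j = w))
        - (if j = e then of_bool (src e = w) else 0)" for j
    using x01[of j] xe by auto
  have "real (card {j. j \<noteq> e \<and> (if x $ j = 0 then src j else tgt j) = w})
      = (\<Sum>j\<in>UNIV. of_bool (src j = w)) - boundary src tgt x $ w - of_bool (src e = w)"
    unfolding card pointwise boundary_nth sum_subtractf by simp
  also have "boundary src tgt x $ w = of_bool (w = v0) - of_bool (src e = w)"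
    by (auto simp: bd axis_def)
  finally show ?thesis
    unfolding card by simp
qed

lemma ex_lattice_direction:
  fixes src tgt :: "'e::finite \<Rightarrow> 'v::finite" and x :: "real^'e"
  assumes sc: "strongly_connected src tgt" and two: "card {j. src j = v0} \<ge> 2"
    and x01: "\<And>j. x $ j = 0 \<or> x $ j = 1" and xe: "x $ e = 0"
    and bd: "boundary src tgt x = axis v0 1 - axis (src e) 1"
  obtains h where "h \<in> H1_int src tgt" "h \<noteq> 0" "h $ e = 0"
    "\<And>j. h $ j = 0 \<or> h $ j = 2 * x $ j - 1"
proof (rule ex_cycle_after_reversal[OF x01])
  fix w
  have "card {j. src j = w} > 0"
    using strongly_connected_surj_src[OF sc] by (auto simp: card_gt_0_iff surj_def) metis
  then have "real (card {j. src j = w}) - of_bool (w = v0) > 0"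
    using two by (cases "w = v0") auto
  then have "card {j. j \<noteq> e \<and> (if x $ j = 0 then src j else tgt j) = w} > 0"
    using outdegree_after_reversal[OF x01 xe bd, of w] by linarith
  then show "\<exists>j. j \<noteq> e \<and> (if x $ j = 0 then src j else tgt j) = w"
    unfolding card_gt_0_iff by blast
qed (rule that)

section \<open>Voronoi cells\<close>

lemma norm_diff_le_iff:
  fixes x \<xi> \<eta> :: "'a::real_inner"
  shows "norm (x - \<xi>) \<le> norm (x - \<eta>) \<longleftrightarrow> 2 * ((x - \<xi>) \<bullet> (\<eta> - \<xi>)) \<le> (\<eta> - \<xi>) \<bullet> (\<eta> - \<xi>)"
  by (simp add: norm_le inner_diff_left inner_diff_right inner_commute algebra_simps)

lemma convex_voronoi_cell:
  assumes "convex H"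
  shows "convex (voronoi_cell H X \<xi>)"
proof -
  have "voronoi_cell H X \<xi>
      = H \<inter> (\<Inter>\<eta>\<in>X. {x. (2 *\<^sub>R (\<eta> - \<xi>)) \<bullet> x \<le> (\<eta> - \<xi>) \<bullet> (\<eta> - \<xi>) + 2 * (\<xi> \<bullet> (\<eta> - \<xi>))})"
    unfolding voronoi_cell_def norm_diff_le_iff
    by (auto simp: inner_diff_left inner_diff_right inner_commute algebra_simps)
  then show ?thesis
    using assms by (simp only: convex_Int convex_INT convex_halfspace_le)
qed

text \<open>The bisecting hyperplane of the two sites supports the cell and cuts out a face through
  \<open>x\<close>. Its normal lies in \<open>H\<close>, so it meets \<open>H\<close> in smaller
  dimension.\<close>

lemma mem_skeleton_if_two_nearest:
  fixes H :: "'a::euclidean_space set"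
  assumes H: "subspace H" and X: "X \<subseteq> H" "\<xi> \<in> X" "\<eta> \<in> X" "\<xi> \<noteq> \<eta>"
    and x: "x \<in> voronoi_cell H X \<xi>" "norm (x - \<eta>) \<le> norm (x - \<xi>)"
  shows "x \<in> skeleton (dim H - 1) (voronoi_tiling H X)"
proof -
  define a where "a = \<eta> - \<xi>"
  define b where "b = (a \<bullet> a) / 2 + a \<bullet> \<xi>"
  have a: "a \<in> H" "a \<noteq> 0"
    using X subspace_diff[OF H] by (auto simp: a_def)
  have le: "norm (y - \<xi>) \<le> norm (y - \<eta>) \<longleftrightarrow> a \<bullet> y \<le> b" for y
    unfolding norm_diff_le_iff
    by (auto simp: a_def b_def inner_diff_left inner_diff_right inner_commute field_simps)
  have ge: "norm (y - \<eta>) \<le> norm (y - \<xi>) \<longleftrightarrow> b \<le> a \<bullet> y" for y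
    unfolding norm_diff_le_iff
    by (auto simp: a_def b_def inner_diff_left inner_diff_right inner_commute field_simps)
  let ?F = "voronoi_cell H X \<xi> \<inter> {y. a \<bullet> y = b}"
  have "?F face_of voronoi_cell H X \<xi>"
  proof (rule face_of_Int_supporting_hyperplane_le)
    show "convex (voronoi_cell H X \<xi>)"
      by (rule convex_voronoi_cell[OF subspace_imp_convex[OF H]])
    show "a \<bullet> y \<le> b" if "y \<in> voronoi_cell H X \<xi>" for y
      using that X le by (auto simp: voronoi_cell_def)
  qed
  then have "?F \<in> voronoi_tiling H X"
    using X by (auto simp: voronoi_tiling_def)
  moreover have "x \<in> ?F"
    using x X le ge by (auto simp: voronoi_cell_def intro: antisym)
  moreover have "aff_dim ?F \<le> int (dim H - 1)"
  proof -
    have "\<not> H \<subseteq> {y. a \<bullet> y = b}"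
    proof
      assume *: "H \<subseteq> {y. a \<bullet> y = b}"
      then have "a \<bullet> 0 = b"
        using subspace_0[OF H] by blast
      moreover have "a \<bullet> a = b"
        using * a by blast
      ultimately show False using a by simp
    qed
    then have "aff_dim (H \<inter> {y. a \<bullet> y = b}) \<le> aff_dim H - 1"
      using aff_dim_affine_Int_hyperplane[OF subspace_imp_affine[OF H], of a b]
      by (auto simp: aff_dim_subspace[OF H] split: if_splits)
    moreover have "aff_dim ?F \<le> aff_dim (H \<inter> {y. a \<bullet> y = b})"
      by (rule aff_dim_subset) (auto simp: voronoi_cell_def)
    ultimately show ?thesis
      by (simp add: aff_dim_subspace[OF H])
  qed
  ultimately show ?thesis
    unfolding skeleton_def by blast
qed

section \<open>The crystal\<close>

text \<open>Lets the comparison of sites in \<open>H\<close> be carried out with unprojected points,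
  coordinate by coordinate in the cube.\<close>

lemma orth_proj_diff_inner:
  assumes "subspace S" "z \<in> S"
  shows "(orth_proj S p - orth_proj S q) \<bullet> z = (p - q) \<bullet> z"
  using orth_proj(2)[OF assms, of p] orth_proj(2)[OF assms, of q]
  by (simp add: orthogonal_def inner_diff_left)

text \<open>The centred unit cube lies in the Voronoi cell of the origin for the integer lattice: in
  each coordinate, an integer is at most its square in absolute value.\<close>

lemma two_cube_inner_le:
  fixes p z :: "real^'n"
  assumes "\<And>j. \<bar>p $ j\<bar> \<le> 1/2" and "\<And>j. z $ j \<in> \<int>"
  shows "2 * (p \<bullet> z) \<le> z \<bullet> z"
proof -
  have "2 * (p $ j * z $ j) \<le> z $ j * z $ j" for j
  proof -
    have "2 * (p $ j * z $ j) \<le> 2 * (\<bar>p $ j\<bar> * \<bar>z $ j\<bar>)"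
      by (metis abs_ge_self abs_mult mult_left_mono zero_le_numeral)
    also have "\<dots> \<le> 1 * \<bar>z $ j\<bar>"
      using assms(1)[of j] mult_right_mono[of "2 * \<bar>p $ j\<bar>" 1 "\<bar>z $ j\<bar>"] by simp
    also have "\<dots> \<le> \<bar>z $ j\<bar> * \<bar>z $ j\<bar>"
    proof (cases "z $ j = 0")
      case False
      then have "1 \<le> \<bar>z $ j\<bar>"
        using assms(2) by (rule Ints_nonzero_abs_ge1[rotated])
      then show ?thesis by (intro mult_right_mono) auto
    qed simp
    finally show ?thesis by (simp add: abs_mult_self_eq)
  qed
  then show ?thesis
    by (simp add: inner_vec_def sum_distrib_left sum_mono)
qed

lemma edge_point_mem_skeleton:
  fixes src tgt :: "'e::finite \<Rightarrow> 'v::finite"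
  assumes sc: "strongly_connected src tgt" and two: "card {j. src j = v0} \<ge> 2"
    and y: "\<And>j. y $ j \<in> \<int>" "boundary src tgt y = axis v0 1 - axis (src e) 1"
    and t: "0 \<le> t" "t \<le> 1"
  shows "orth_proj (H1 src tgt) (y + t *\<^sub>R axis e 1)
    \<in> skeleton (dim (H1 src tgt) - 1) (voronoi_tiling (H1 src tgt) (crystal_sites src tgt))"
proof -
  define H where "H = H1 src tgt"
  have H: "subspace H"
    by (simp add: H_def subspace_H1)
  have intH: "m \<in> H" if "m \<in> H1_int src tgt" for m
    using that by (simp add: H_def H1_int_def)
  define c :: "real^'e" where "c = (1/2) *\<^sub>R (\<Sum>j\<in>UNIV. axis j 1)"
  have c_nth: "c $ j = 1/2" for j
    by (simp add: c_def axis_def)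
  define \<xi>0 where "\<xi>0 = orth_proj H c"
  have sites: "crystal_sites src tgt = (+) \<xi>0 ` H1_int src tgt"
    by (simp add: crystal_sites_def \<xi>0_def H_def c_def)
  obtain x where x: "\<And>j. x $ j = 0 \<or> x $ j = 1" "\<And>j. src j = src e \<Longrightarrow> x $ j = 0"
    "boundary src tgt x = axis v0 1 - axis (src e) 1"
    using ex_path_chain[OF sc, of "src e" v0] by blast
  obtain h where h: "h \<in> H1_int src tgt" "h \<noteq> 0" "h $ e = 0"
    "\<And>j. h $ j = 0 \<or> h $ j = 2 * x $ j - 1"
    using ex_lattice_direction[OF sc two x(1) x(2)[OF refl] x(3)] by blast
  \<comment> \<open>Both chains join \<open>v0\<close> to \<open>src e\<close>, so they differ by a
    lattice vector; translating by it reduces the general walk to the shortest path.\<close>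
  define k where "k = y - x"
  have "x $ j \<in> \<int>" for j
    using x(1)[of j] by auto
  then have k: "k \<in> H1_int src tgt"
    using y x(3) by (simp add: k_def H1_int_def H1_def linear_diff[OF linear_boundary])
  define p where "p = x + t *\<^sub>R axis e 1 - c"
  define X where "X = orth_proj H (y + t *\<^sub>R axis e 1)"
  have inner: "(X - (\<xi>0 + k)) \<bullet> z = p \<bullet> z" if "z \<in> H" for z
    using orth_proj_diff_inner[OF H that, of "y + t *\<^sub>R axis e 1" c]
    by (simp add: X_def \<xi>0_def p_def k_def inner_diff_left inner_add_left)
  have p_nth: "p $ j = x $ j - 1/2 + (if j = e then t else 0)" for j
    by (simp add: p_def c_nth axis_def)
  \<comment> \<open>As \<open>x $ e = 0\<close>, coordinate \<open>e\<close> runs from -1/2 to 1/2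
    with \<open>t\<close>; every other coordinate is one of these two values.\<close>
  have p_bound: "\<bar>p $ j\<bar> \<le> 1/2" for j
    using x(1)[of j] x(2)[of e] t by (auto simp: p_nth abs_if)
  have cell: "X \<in> voronoi_cell H (crystal_sites src tgt) (\<xi>0 + k)"
    unfolding voronoi_cell_def
  proof (intro CollectI conjI ballI)
    show "X \<in> H"
      using orth_proj(1)[OF H] by (simp add: X_def)
    fix \<eta> assume "\<eta> \<in> crystal_sites src tgt"
    then obtain m where m: "m \<in> H1_int src tgt" "\<eta> = \<xi>0 + m"
      by (auto simp: sites)
    have d: "m - k \<in> H1_int src tgt"
      using m(1) k by (rule H1_int_diff)
    then have "2 * (p \<bullet> (m - k)) \<le> (m - k) \<bullet> (m - k)"
      by (intro two_cube_inner_le[OF p_bound]) (simp add: H1_int_def)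
    then show "norm (X - (\<xi>0 + k)) \<le> norm (X - \<eta>)"
      unfolding norm_diff_le_iff using inner[OF intH[OF d]] by (simp add: m(2))
  qed
  have "2 * (p \<bullet> h) = h \<bullet> h"
  proof -
    have "2 * (p $ j * h $ j) = h $ j * h $ j" for j
    proof (cases "h $ j = 0")
      case False
      \<comment> \<open>Here \<open>j\<close> differs from \<open>e\<close>, because
        \<open>h $ e = 0\<close>; so \<open>t\<close> does not enter.\<close>
      then have "2 * p $ j = h $ j"
        using h(3) h(4)[of j] by (auto simp: p_nth)
      then show ?thesis by simp
    qed simp
    then show ?thesis
      unfolding inner_vec_def sum_distrib_left by (intro sum.cong) (simp_all only: inner_real_def)
  qed
  moreover have "(X - (\<xi>0 + (k + h))) \<bullet> h = p \<bullet> h - h \<bullet> h"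
    using inner[OF intH[OF h(1)]] by (simp add: inner_diff_left inner_add_left)
  ultimately have near: "norm (X - (\<xi>0 + (k + h))) \<le> norm (X - (\<xi>0 + k))"
    unfolding norm_diff_le_iff by simp
  show ?thesis
    unfolding H_def[symmetric] X_def[symmetric]
  proof (rule mem_skeleton_if_two_nearest[OF H _ _ _ _ cell near])
    show "crystal_sites src tgt \<subseteq> H"
      using orth_proj(1)[OF H] intH by (auto simp: sites \<xi>0_def intro: subspace_add[OF H])
    show "\<xi>0 + k \<in> crystal_sites src tgt" "\<xi>0 + (k + h) \<in> crystal_sites src tgt"
      using k h(1) by (auto simp: sites intro: H1_int_add)
  qed (use h(2) in simp)
qed

lemma walk_chain_Ints: "walk_chain ds l $ j \<in> \<int>"
  by (auto simp: walk_chain_def axis_def intro!: Ints_sum)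

lemma walk_chain_Suc:
  "walk_chain ds (Suc l) = walk_chain ds l + of_int (fst (ds ! l)) *\<^sub>R axis (snd (ds ! l)) 1"
  by (simp add: walk_chain_def)

lemma boundary_walk_chain:
  assumes "is_walk src tgt v0 vs ds" "l \<le> length ds"
  shows "boundary src tgt (walk_chain ds l) = axis v0 1 - axis (vs ! l) 1"
  using assms(2)
proof (induction l)
  case 0
  then show ?case
    using assms(1) by (simp add: walk_chain_def is_walk_def linear_0[OF linear_boundary])
next
  case (Suc l)
  then have "signed_edge_from_to src tgt (ds ! l) (vs ! l) (vs ! Suc l)"
    using assms(1) by (simp add: is_walk_def)
  then show ?case
    using Suc by (auto simp: walk_chain_Suc linear_add[OF linear_boundary]
        linear_cmul[OF linear_boundary] linear_neg[OF linear_boundary] boundary_axis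
        signed_edge_from_to_def)
qed

lemma crystal_subset_skeleton:
  fixes src tgt :: "'e::finite \<Rightarrow> 'v::finite"
  assumes sc: "strongly_connected src tgt" and two: "card {j. src j = v0} \<ge> 2"
  shows "crystal src tgt v0
    \<subseteq> skeleton (dim (H1 src tgt) - 1) (voronoi_tiling (H1 src tgt) (crystal_sites src tgt))"
    (is "_ \<subseteq> ?S")
proof
  fix q assume "q \<in> crystal src tgt v0"
  then obtain vs ds p where w: "is_walk src tgt v0 vs ds" and p: "p \<in> pc ds"
    and q: "q = orth_proj (H1 src tgt) p"
    by (auto simp: crystal_def)
  obtain l where l: "l < length ds"
    and seg: "p \<in> closed_segment (walk_chain ds l) (walk_chain ds (Suc l))"
    using p by (auto simp: pc_def) (metis Suc_le_eq Suc_pred)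
  define e where "e = snd (ds ! l)"
  let ?a = "walk_chain ds l" and ?b = "walk_chain ds (Suc l)"
  have dir: "signed_edge_from_to src tgt (ds ! l) (vs ! l) (vs ! Suc l)"
    using w l by (simp add: is_walk_def)
  have bd: "boundary src tgt ?a = axis v0 1 - axis (vs ! l) 1"
    "boundary src tgt ?b = axis v0 1 - axis (vs ! Suc l) 1"
    using boundary_walk_chain[OF w] l by auto
  \<comment> \<open>An edge traversed backwards is the same segment read from its other end, where
    the walk is at \<open>src e\<close>.\<close>
  obtain y where y: "\<And>j. y $ j \<in> \<int>" "boundary src tgt y = axis v0 1 - axis (src e) 1"
    "p \<in> closed_segment y (y + axis e 1)"
  proof (cases "fst (ds ! l) = 1")
    case True
    then show ?thesis
      using dir bd seg walk_chain_Ints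
      by (intro that[of ?a]) (auto simp: walk_chain_Suc signed_edge_from_to_def e_def)
  next
    case False
    then have "?a = ?b + axis e 1" "src e = vs ! Suc l"
      using dir by (auto simp: walk_chain_Suc signed_edge_from_to_def e_def)
    then show ?thesis
      using bd seg walk_chain_Ints
      by (intro that[of ?b]) (auto simp: closed_segment_commute)
  qed
  obtain t where t: "0 \<le> t" "t \<le> 1" "p = (1 - t) *\<^sub>R y + t *\<^sub>R (y + axis e 1)"
    using y(3) by (auto simp: in_segment)
  have "p = y + t *\<^sub>R axis e 1"
    by (simp add: t(3) algebra_simps)
  then show "q \<in> ?S"
    using edge_point_mem_skeleton[OF sc two y(1,2) t(1,2)] q by simp
qed

theorem theorem3p1:
  fixes G :: "('e::finite, 'v::finite) mgraph"
  assumes "connected_graph G"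
    and "bridgeless G"
    and "betti1 G \<ge> 2"
  shows "\<exists>src tgt v0. orientation G src tgt \<and> strongly_connected src tgt \<and>
    (\<exists>r < betti1 G. crystal src tgt v0 \<subseteq>
       skeleton r (voronoi_tiling (H1 src tgt) (crystal_sites src tgt)))"
proof -
  obtain src tgt where ori: "orientation G src tgt" and sc: "strongly_connected src tgt"
    using ex_strong_orientation[OF assms(1,2)] .
  have dim: "dim (H1 src tgt) = betti1 G"
    by (rule dim_H1[OF ori])
  \<comment> \<open>Two edges sharing a source provide the base vertex of out-degree at least
    two.\<close>
  have "\<not> inj src"
    using dim_H1_le_1_if_inj_src[OF sc] assms(3) dim by auto
  then obtain i j where ij: "src i = src j" "i \<noteq> j"
    by (auto simp: inj_def)
  have "card {i, j} \<le> card {k. src k = src j}"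
    using ij by (intro card_mono) auto
  then have "card {k. src k = src j} \<ge> 2"
    using ij by simp
  then have "crystal src tgt (src j)
      \<subseteq> skeleton (betti1 G - 1) (voronoi_tiling (H1 src tgt) (crystal_sites src tgt))"
    using crystal_subset_skeleton[OF sc] dim by simp
  moreover have "betti1 G - 1 < betti1 G"
    using assms(3) by simp
  ultimately show ?thesis
    using ori sc by blast
qed

end
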